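(* Let $a_1,a_2,a_3>0$ and $y_1,y_2,y_3>0$ be real numbers such that \[ y_1+y_2+y_3\ge a_1+a_2+a_3,\qquad y_1y_2+y_2y_3+y_1y_3\ge a_1a_2+a_2a_3+a_1a_3,\qquad y_1y_2y_3=a_1a_2a_3 . \] Then \[ (\log y_1)^2+(\log y_2)^2+(\log y_3)^2\ \ge\ (\log a_1)^2+(\log a_2)^2+(\log a_3)^2 . \]
   Context: $\log$ is the real natural logarithm. *)

theory Defs
  imports Complex_Main
begin

end

theory Submission
  imports Defs "HOL-Analysis.Interval_Integral"
begin

text \<open>
  The hypotheses compare the coefficients of the polynomials \<open>\<Prod>i. (1 + t * y i)\<close> and
  \<open>\<Prod>i. (1 + t * a i)\<close>, so the first dominates the second for every \<open>t > 0\<close>. Taking logarithms and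
  writing \<open>t = exp u\<close>, \<open>y i = exp (b i)\<close>, \<open>a i = exp (c i)\<close>, this says that
  \<open>D u = (\<Sum>i. \<phi> (u + b i)) - (\<Sum>i. \<phi> (u + c i))\<close> is nonnegative for every real \<open>u\<close>, where
  \<open>\<phi> u = ln (1 + exp u)\<close>. The sum of squared logarithms is recovered by integration:
  the integral of \<open>D\<close> over the real line is \<open>(\<Sum>i. (b i)\<^sup>2 - (c i)\<^sup>2) / 2\<close> whenever
  \<open>\<Sum>i. b i = \<Sum>i. c i\<close>, that is, whenever the products of the \<open>y i\<close> and of the \<open>a i\<close> agree.

  To evaluate this integral, let \<open>\<Phi>\<close> be an antiderivative of \<open>\<phi>\<close>. Since \<open>0 \<le> \<phi> \<le> exp\<close>, differences
  \<open>\<Phi> (u + b i) - \<Phi> (u + c i)\<close> vanish as \<open>u\<close> tends to minus infinity. The behaviour at plus infinity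
  reduces to this by reflection: \<open>\<phi> u - \<phi> (-u) = u\<close>, so \<open>\<Phi> u + \<Phi> (-u)\<close> is \<open>u\<^sup>2 / 2\<close> up to a constant,
  and this is where the squares come from. The argument works for any number of variables.
\<close>

definition softplus :: "real \<Rightarrow> real" where
  "softplus u = ln (1 + exp u)"

lemma softplus_nonneg: "0 \<le> softplus u"
  by (simp add: softplus_def)

lemma softplus_le_exp: "softplus u \<le> exp u"
  unfolding softplus_def by (rule ln_add_one_self_le_self) simp

lemma softplus_reflect: "softplus u - softplus (- u) = u"
proof -
  have "1 + exp u = exp u * (1 + exp (- u))"
    by (simp add: distrib_left flip: exp_add)
  moreover have "1 + exp (- u) > 0"
    by (simp add: add_pos_pos)
  ultimately have "ln (1 + exp u) = u + ln (1 + exp (- u))"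
    by (simp add: ln_mult)
  then show ?thesis
    by (simp add: softplus_def)
qed

lemma softplus_antiderivative:
  obtains \<Phi> where "\<And>x. (\<Phi> has_real_derivative softplus x) (at x)"
proof -
  have "isCont softplus x" for x
  proof -
    have "1 + exp x \<noteq> 0"
      using exp_gt_zero[of x] by linarith
    then show ?thesis
      unfolding softplus_def by (intro continuous_intros) auto
  qed
  then have "\<exists>\<Phi>. \<forall>x. -\<infinity> < ereal x \<longrightarrow> ereal x < \<infinity> \<longrightarrow> (\<Phi> has_vector_derivative softplus x) (at x)"
    by (intro einterval_antiderivative) auto
  then show ?thesis
    using that by (auto simp: has_real_derivative_iff_has_vector_derivative)
qed

lemma softplus_antiderivative_reflect:
  assumes "\<And>x. (\<Phi> has_real_derivative softplus x) (at x)"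
  shows "\<Phi> x + \<Phi> (- x) = x\<^sup>2 / 2 + 2 * \<Phi> 0"
proof -
  have "((\<lambda>x. \<Phi> x + \<Phi> (- x) - x\<^sup>2 / 2) has_real_derivative 0) (at x)" for x
  proof -
    have "((\<lambda>x. \<Phi> x + \<Phi> (- x) - x\<^sup>2 / 2) has_real_derivative
        softplus x + softplus (- x) * (- 1) - x) (at x)"
      by (auto intro!: derivative_eq_intros assms DERIV_chain2[OF assms])
    then show ?thesis
      using softplus_reflect[of x] by (simp add: algebra_simps)
  qed
  then have "\<Phi> x + \<Phi> (- x) - x\<^sup>2 / 2 = \<Phi> 0 + \<Phi> (- 0) - 0\<^sup>2 / 2"
    by (intro DERIV_isconst_all[of "\<lambda>x. \<Phi> x + \<Phi> (- x) - x\<^sup>2 / 2"]) auto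
  then show ?thesis by simp
qed

text \<open>
  Both \<open>\<Phi>\<close> and \<open>exp - \<Phi>\<close> are nondecreasing. The bound makes differences of \<open>\<Phi>\<close> at two points of
  fixed distance decay exponentially when both points move to minus infinity.
\<close>

lemma softplus_antiderivative_diff_le:
  assumes \<Phi>: "\<And>x. (\<Phi> has_real_derivative softplus x) (at x)"
  shows "\<bar>\<Phi> p - \<Phi> q\<bar> \<le> \<bar>exp p - exp q\<bar>"
proof -
  have 1: "\<Phi> p \<le> \<Phi> q" if "p \<le> q" for p q
    using that \<Phi> softplus_nonneg by (intro DERIV_nonneg_imp_nondecreasing[of p q \<Phi>]) auto
  have 2: "exp p - \<Phi> p \<le> exp q - \<Phi> q" if "p \<le> q" for p q
  proof (rule DERIV_nonneg_imp_nondecreasing[OF that])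
    fix x :: real
    have "((\<lambda>x. exp x - \<Phi> x) has_real_derivative exp x - softplus x) (at x)"
      by (intro DERIV_diff DERIV_exp \<Phi>)
    then show "\<exists>d. ((\<lambda>x. exp x - \<Phi> x) has_real_derivative d) (at x) \<and> 0 \<le> d"
      using softplus_le_exp[of x] by auto
  qed
  show ?thesis
    using 1[of p q] 1[of q p] 2[of p q] 2[of q p] by linarith
qed

text \<open>
  This is the positivity of the integral of a nonnegative \<open>D\<close>, with the improper integral replaced
  by the integral \<open>S u - S (-u)\<close> over a symmetric interval and explicit error terms of size \<open>exp (-u)\<close>.
\<close>

lemma sum_squares_mono_softplus:
  fixes b c :: "'a \<Rightarrow> real"
  assumes sum_eq: "(\<Sum>i\<in>I. c i) = (\<Sum>i\<in>I. b i)"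
    and le: "\<And>u. (\<Sum>i\<in>I. softplus (u + c i)) \<le> (\<Sum>i\<in>I. softplus (u + b i))"
  shows "(\<Sum>i\<in>I. (c i)\<^sup>2) \<le> (\<Sum>i\<in>I. (b i)\<^sup>2)"
proof -
  obtain \<Phi> where \<Phi>: "\<And>x. (\<Phi> has_real_derivative softplus x) (at x)"
    using softplus_antiderivative by blast
  define S where "S u = (\<Sum>i\<in>I. \<Phi> (u + b i) - \<Phi> (u + c i))" for u
  define R where "R u = (\<Sum>i\<in>I. \<Phi> (- (u + b i)) - \<Phi> (- (u + c i)))" for u
  define Q where "Q = ((\<Sum>i\<in>I. (b i)\<^sup>2) - (\<Sum>i\<in>I. (c i)\<^sup>2)) / 2"
  define A where "A = (\<Sum>i\<in>I. \<bar>exp (b i) - exp (c i)\<bar>)"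
  define B where "B = (\<Sum>i\<in>I. \<bar>exp (- b i) - exp (- c i)\<bar>)"

  have S_mono: "S u \<le> S v" if "u \<le> v" for u v
  proof (rule DERIV_nonneg_imp_nondecreasing[OF that])
    fix x :: real
    have "(S has_real_derivative (\<Sum>i\<in>I. softplus (x + b i) * 1 - softplus (x + c i) * 1)) (at x)"
      unfolding S_def
      by (intro DERIV_sum DERIV_diff DERIV_chain2[OF \<Phi>]) (auto intro!: derivative_eq_intros)
    moreover have "0 \<le> (\<Sum>i\<in>I. softplus (x + b i) * 1 - softplus (x + c i) * 1)"
      using le[of x] by (simp add: sum_subtractf)
    ultimately show "\<exists>d. (S has_real_derivative d) (at x) \<and> 0 \<le> d"
      by blast
  qed

  have Q_split: "Q = S u + R u" for u
  proof -
    have "S u + R u = (\<Sum>i\<in>I. (\<Phi> (u + b i) + \<Phi> (- (u + b i))) - (\<Phi> (u + c i) + \<Phi> (- (u + c i))))"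
      by (simp add: S_def R_def algebra_simps flip: sum.distrib)
    also have "\<dots> = (\<Sum>i\<in>I. ((b i)\<^sup>2 - (c i)\<^sup>2) / 2 + u * (b i - c i))"
      unfolding softplus_antiderivative_reflect[OF \<Phi>]
      by (intro sum.cong) (auto simp: power2_eq_square field_simps)
    \<comment> \<open>The cross terms cancel because the two families have the same sum.\<close>
    also have "\<dots> = Q + u * ((\<Sum>i\<in>I. b i) - (\<Sum>i\<in>I. c i))"
      by (simp add: Q_def sum.distrib sum_subtractf flip: sum_divide_distrib sum_distrib_left)
    finally show ?thesis
      using sum_eq by simp
  qed

  have S_bound: "\<bar>S (- u)\<bar> \<le> exp (- u) * A" for u
  proof -
    have "\<bar>S (- u)\<bar> \<le> (\<Sum>i\<in>I. \<bar>exp (- u + b i) - exp (- u + c i)\<bar>)"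
      unfolding S_def
      by (rule order_trans[OF sum_abs]) (intro sum_mono softplus_antiderivative_diff_le \<Phi>)
    also have "\<dots> = exp (- u) * A"
      unfolding A_def sum_distrib_left exp_add
      by (simp add: abs_mult flip: right_diff_distrib)
    finally show ?thesis .
  qed
  have R_bound: "\<bar>R u\<bar> \<le> exp (- u) * B" for u
  proof -
    have "\<bar>R u\<bar> \<le> (\<Sum>i\<in>I. \<bar>exp (- (u + b i)) - exp (- (u + c i))\<bar>)"
      unfolding R_def
      by (rule order_trans[OF sum_abs]) (intro sum_mono softplus_antiderivative_diff_le \<Phi>)
    also have "\<dots> = exp (- u) * B"
      unfolding B_def sum_distrib_left minus_add_distrib exp_add
      by (simp add: abs_mult flip: right_diff_distrib)
    finally show ?thesis .
  qed

  have "- (exp (- u) * (A + B)) \<le> Q" if "0 \<le> u" for u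
    using Q_split[of u] S_mono[of "- u" u] S_bound[of u] R_bound[of u] that
    by (simp add: distrib_left)
  then have "eventually (\<lambda>u. - (exp (- u) * (A + B)) \<le> Q) at_top"
    unfolding eventually_at_top_linorder by blast
  moreover have "((\<lambda>u::real. - (exp (- u) * (A + B))) \<longlongrightarrow> - (0 * (A + B))) at_top"
    by (intro tendsto_intros filterlim_compose[OF exp_at_bot] filterlim_uminus_at_bot_at_top)
  ultimately have "- (0 * (A + B)) \<le> Q"
    by (intro tendsto_upperbound) auto
  then show ?thesis
    by (simp add: Q_def)
qed

text \<open>
  The sum of squared logarithms inequality in any number of variables, with the comparison of
  elementary symmetric polynomials relaxed to that of the generating polynomials on the positive axis.
\<close>

lemma sum_squared_ln_mono:
  fixes a y :: "'a \<Rightarrow> real"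
  assumes "finite I"
    and a: "\<And>i. i \<in> I \<Longrightarrow> 0 < a i" and y: "\<And>i. i \<in> I \<Longrightarrow> 0 < y i"
    and prod_eq: "(\<Prod>i\<in>I. a i) = (\<Prod>i\<in>I. y i)"
    and le: "\<And>t. 0 < t \<Longrightarrow> (\<Prod>i\<in>I. 1 + t * a i) \<le> (\<Prod>i\<in>I. 1 + t * y i)"
  shows "(\<Sum>i\<in>I. (ln (a i))\<^sup>2) \<le> (\<Sum>i\<in>I. (ln (y i))\<^sup>2)"
proof (rule sum_squares_mono_softplus)
  show "(\<Sum>i\<in>I. ln (a i)) = (\<Sum>i\<in>I. ln (y i))"
    using prod_eq ln_prod[of I a] ln_prod[of I y] \<open>finite I\<close> a y by (metis less_irrefl)
next
  have softplus_sum: "(\<Sum>i\<in>I. softplus (u + ln (x i))) = ln (\<Prod>i\<in>I. 1 + exp u * x i)"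
    if "\<And>i. i \<in> I \<Longrightarrow> 0 < x i" for x :: "'a \<Rightarrow> real" and u
  proof -
    have "1 + exp u * x i \<noteq> 0" if "i \<in> I" for i
      using \<open>\<And>i. i \<in> I \<Longrightarrow> 0 < x i\<close>[OF that] by (intro less_imp_neq[symmetric]) (simp add: add_pos_pos)
    then show ?thesis
      using that \<open>finite I\<close> by (simp add: ln_prod softplus_def exp_add)
  qed
  fix u :: real
  have "0 < (\<Prod>i\<in>I. 1 + exp u * a i)"
    using a by (intro prod_pos) (simp add: add_pos_pos)
  then show "(\<Sum>i\<in>I. softplus (u + ln (a i))) \<le> (\<Sum>i\<in>I. softplus (u + ln (y i)))"
    using le[of "exp u"] by (simp add: softplus_sum a y)
qed

theorem theorem2:
  fixes a1 a2 a3 y1 y2 y3 :: real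
  assumes "a1 > 0" and "a2 > 0" and "a3 > 0"
    and "y1 > 0" and "y2 > 0" and "y3 > 0"
    and "y1 + y2 + y3 \<ge> a1 + a2 + a3"
    and "y1 * y2 + y2 * y3 + y1 * y3 \<ge> a1 * a2 + a2 * a3 + a1 * a3"
    and "y1 * y2 * y3 = a1 * a2 * a3"
  shows "(ln y1)\<^sup>2 + (ln y2)\<^sup>2 + (ln y3)\<^sup>2 \<ge> (ln a1)\<^sup>2 + (ln a2)\<^sup>2 + (ln a3)\<^sup>2"
proof -
  define a where "a = (\<lambda>i. [a1, a2, a3] ! i)"
  define y where "y = (\<lambda>i. [y1, y2, y3] ! i)"
  have lessThan_3: "{..<3::nat} = {0, 1, 2}"
    by auto
  have prod_expand: "(1 + t * p) * ((1 + t * q) * (1 + t * r))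
      = 1 + t * (p + q + r) + t\<^sup>2 * (p * q + q * r + p * r) + t ^ 3 * (p * q * r)" for t p q r :: real
    by (simp add: power2_eq_square power3_eq_cube algebra_simps)
  have "(\<Sum>i<3. (ln (a i))\<^sup>2) \<le> (\<Sum>i<3. (ln (y i))\<^sup>2)"
  proof (rule sum_squared_ln_mono)
    show "(\<Prod>i<3. a i) = (\<Prod>i<3. y i)"
      using assms(9) by (simp add: lessThan_3 a_def y_def mult.assoc)
    show "(\<Prod>i<3. 1 + t * a i) \<le> (\<Prod>i<3. 1 + t * y i)" if "0 < t" for t
    proof -
      have "t * (a1 + a2 + a3) \<le> t * (y1 + y2 + y3)"
        and "t\<^sup>2 * (a1 * a2 + a2 * a3 + a1 * a3) \<le> t\<^sup>2 * (y1 * y2 + y2 * y3 + y1 * y3)"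
        using assms that by (auto intro!: mult_left_mono)
      then have "(1 + t * a1) * ((1 + t * a2) * (1 + t * a3))
          \<le> (1 + t * y1) * ((1 + t * y2) * (1 + t * y3))"
        unfolding prod_expand assms(9) by linarith
      then show ?thesis
        by (simp add: lessThan_3 a_def y_def)
    qed
  qed (use assms in \<open>auto simp: lessThan_3 a_def y_def\<close>)
  then show ?thesis
    by (simp add: lessThan_3 a_def y_def add.assoc)
qed

end
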